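(* Let $A$ be a finite-dimensional evolution algebra over a field. For two-element subsets $\{X,Y\}\subseteq\operatorname{evlattid}(A)$ put $\operatorname{evsup}(\{X,Y\}):=\operatorname{MinEvid}(X\cup Y)$ and $\operatorname{evinf}(\{X,Y\}):=\operatorname{MaxEvid}(X\cap Y)$. Then the quadruple $(\operatorname{evlattid}(A),\subseteq,\operatorname{evinf},\operatorname{evsup})$ is an evlattice over the lattice $(\operatorname{lattid}(A),\subseteq,\inf,\sup)$.
   Context: An algebra over a field $\mathbb{K}$ is a $\mathbb{K}$-vector space with a bilinear multiplication (not necessarily associative). "Ideal" means two-sided ideal. A natural basis of an algebra is a vector space basis $\{e_i\}$ with $e_ie_j=0$ for $i\neq j$; an evolution algebra is an algebra having a natural basis. An evolution ideal of $A$ is an ideal of $A$ which, as an algebra, has a natural basis; $\{0\}$ is an evolution ideal (with empty natural basis). $\operatorname{lattid}(A)$ is the lattice of all ideals of $A$ ordered by inclusion, with $\inf(\{X,Y\})=X\cap Y$ and $\sup(\{X,Y\})=\operatorname{id}(X\cup Y)$, the ideal generated by $X\cup Y$. $\operatorname{evlattid}(A)\subseteq\operatorname{lattid}(A)$ is the subset of evolution ideals, ordered by inclusion. For $S\subseteq A$, $\operatorname{MinEvid}(S)$ is the set of all evolution ideals of $A$ containing $S$ that are minimal (for inclusion) among the evolution ideals of $A$ containing $S$; $\operatorname{MaxEvid}(S)$ is the set of all evolution ideals of $A$ contained in $S$ that are maximal among the evolution ideals of $A$ contained in $S$. Let $(L,\leq_L)$ be a lattice (every two-element subset has an infimum and a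 supremum), let $E\subseteq L$ with the restricted relation $\leq_E$, let $\binom{E}{2}$ be the set of two-element subsets of $E$, and let $\operatorname{Br}(L)$ be the set of non-empty subsets of $L$. Let $f,g\colon\binom{E}{2}\to\operatorname{Br}(L)$ be maps. The quadruple $(E,\leq_E,f,g)$ is an evlattice over $(L,\leq_L,\inf,\sup)$ if for every two-element subset $\{a,b\}\subseteq E$: every $x\in f(\{a,b\})$ satisfies $x\leq_L\inf(\{a,b\})$, and every $x\in g(\{a,b\})$ satisfies $\sup(\{a,b\})\leq_L x$ (infimum and supremum taken in $L$). *)

theory Defs
  imports Complex_Main "HOL-Algebra.Lattice" "HOL-Library.FuncSet" "HOL-Library.Ramsey"
begin

locale nonassoc_algebra = vector_space scale
  for scale :: "'a::field \<Rightarrow> 'b::ab_group_add \<Rightarrow> 'b" (infixr \<open>*s\<close> 75) +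
  fixes mult :: "'b \<Rightarrow> 'b \<Rightarrow> 'b" (infixl \<open>\<star>\<close> 70)
  assumes linear_mult_right: "Vector_Spaces.linear scale scale (\<lambda>y. x \<star> y)"
    and linear_mult_left: "Vector_Spaces.linear scale scale (\<lambda>x. x \<star> y)"
begin

definition two_sided_ideal :: "'b set \<Rightarrow> bool"
  where "two_sided_ideal I \<longleftrightarrow> subspace I \<and> (\<forall>x\<in>I. \<forall>a. a \<star> x \<in> I \<and> x \<star> a \<in> I)"

text \<open>The first argument is the underlying set of the algebra: \<open>UNIV\<close> for the
  whole algebra, or a subspace closed under multiplication, such as an ideal.\<close>

definition natural_basis :: "'b set \<Rightarrow> 'b set \<Rightarrow> bool"
  where "natural_basis U B \<longleftrightarrow>
    independent B \<and> span B = U \<and> (\<forall>x\<in>B. \<forall>y\<in>B. x \<noteq> y \<longrightarrow> x \<star> y = 0)"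

definition evolution_algebra_on :: "'b set \<Rightarrow> bool"
  where "evolution_algebra_on U \<longleftrightarrow> (\<exists>B. natural_basis U B)"

definition generated_ideal :: "'b set \<Rightarrow> 'b set"
  where "generated_ideal S = two_sided_ideal hull S"

definition lattid :: "'b set gorder"
  where "lattid = \<lparr>carrier = {I. two_sided_ideal I}, eq = (=), le = (\<subseteq>)\<rparr>"

definition evlattid :: "'b set set"
  where "evlattid = {I. two_sided_ideal I \<and> evolution_algebra_on I}"

definition MinEvid :: "'b set \<Rightarrow> 'b set set"
  where "MinEvid S =
    {M \<in> evlattid. S \<subseteq> M \<and> (\<forall>N\<in>evlattid. S \<subseteq> N \<and> N \<subseteq> M \<longrightarrow> N = M)}"

definition MaxEvid :: "'b set \<Rightarrow> 'b set set"
  where "MaxEvid S =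
    {M \<in> evlattid. M \<subseteq> S \<and> (\<forall>N\<in>evlattid. N \<subseteq> S \<and> M \<subseteq> N \<longrightarrow> N = M)}"

text \<open>The following operations are meant for arguments \<open>{X, Y}\<close>, where
  \<open>\<Inter>{X, Y} = X \<inter> Y\<close> and \<open>\<Union>{X, Y} = X \<union> Y\<close>.\<close>

definition lattid_inf :: "'b set set \<Rightarrow> 'b set"
  where "lattid_inf P = \<Inter>P"

definition lattid_sup :: "'b set set \<Rightarrow> 'b set"
  where "lattid_sup P = generated_ideal (\<Union>P)"

definition evinf :: "'b set set \<Rightarrow> 'b set set"
  where "evinf P = MaxEvid (\<Inter>P)"

definition evsup :: "'b set set \<Rightarrow> 'b set set"
  where "evsup P = MinEvid (\<Union>P)"

end

definition nonempty_subsets :: "('c, 'm) gorder_scheme \<Rightarrow> 'c set set"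
  where "nonempty_subsets L = {S. S \<subseteq> carrier L \<and> S \<noteq> {}}"

text \<open>The quadruple \<open>(E, leE, f, g)\<close> is an evlattice over the lattice
  \<open>(L, infL, supL)\<close>; the order of the lattice is part of the record \<open>L\<close>. The
  two-element subsets of a set \<open>E\<close> are \<open>nsets E 2\<close>; the operations
  \<open>infL\<close>, \<open>supL\<close>, \<open>f\<close> and \<open>g\<close> are relevant only on such sets.\<close>

locale evlattice = lattice L
  for L :: "('c, 'm) gorder_scheme" (structure) +
  fixes infL supL :: "'c set \<Rightarrow> 'c"
    and E :: "'c set"
    and leE :: "'c \<Rightarrow> 'c \<Rightarrow> bool"
    and f g :: "'c set \<Rightarrow> 'c set"
  assumes infL: "P \<in> nsets (carrier L) 2 \<Longrightarrow> greatest L (infL P) (Lower L P)"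
    and supL: "P \<in> nsets (carrier L) 2 \<Longrightarrow> least L (supL P) (Upper L P)"
    and subset_carrier: "E \<subseteq> carrier L"
    and leE: "x \<in> E \<Longrightarrow> y \<in> E \<Longrightarrow> leE x y \<longleftrightarrow> x \<sqsubseteq> y"
    and f_maps: "f \<in> nsets E 2 \<rightarrow> nonempty_subsets L"
    and g_maps: "g \<in> nsets E 2 \<rightarrow> nonempty_subsets L"
    and f_le_infL: "P \<in> nsets E 2 \<Longrightarrow> x \<in> f P \<Longrightarrow> x \<sqsubseteq> infL P"
    and supL_le_g: "P \<in> nsets E 2 \<Longrightarrow> x \<in> g P \<Longrightarrow> supL P \<sqsubseteq> x"

end

theory Submission
  imports Defs
begin

text \<open>The zero ideal and the whole algebra are evolution ideals, so among the evolution ideals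
  contained in \<open>X \<inter> Y\<close>, respectively containing \<open>X \<union> Y\<close>, one of largest, respectively smallest,
  dimension exists; it is maximal, respectively minimal, because comparable subspaces of equal
  finite dimension coincide.\<close>

context nonassoc_algebra
begin

lemma mult_zero_right: "x \<star> 0 = 0"
  using module_hom.zero[OF linear_mult_right[unfolded linear_iff_module_hom]] .

lemma mult_zero_left: "0 \<star> y = 0"
  using module_hom.zero[OF linear_mult_left[unfolded linear_iff_module_hom]] .

lemma two_sided_ideal_zero: "two_sided_ideal {0}"
  by (auto simp: two_sided_ideal_def subspace_single_0 mult_zero_right mult_zero_left)

lemma two_sided_ideal_UNIV: "two_sided_ideal UNIV"
  by (simp add: two_sided_ideal_def)

lemma two_sided_ideal_Inter:
  assumes "\<And>I. I \<in> F \<Longrightarrow> two_sided_ideal I"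
  shows "two_sided_ideal (\<Inter>F)"
  using assms unfolding two_sided_ideal_def by (auto intro!: subspace_Inter)

text \<open>The hull is the intersection of all ideals containing \<open>S\<close>, and ideals are
  closed under arbitrary intersections.\<close>

lemma two_sided_ideal_generated_ideal: "two_sided_ideal (generated_ideal S)"
  unfolding generated_ideal_def by (rule hull_in) (rule two_sided_ideal_Inter, blast)

lemma zero_in_evlattid: "{0} \<in> evlattid"
proof -
  \<comment> \<open>The span of the empty set is the zero space.\<close>
  have "natural_basis {0} {}"
    by (simp add: natural_basis_def independent_empty)
  then show ?thesis
    unfolding evlattid_def evolution_algebra_on_def using two_sided_ideal_zero by blast
qed

lemma evlattid_subspace: "I \<in> evlattid \<Longrightarrow> subspace I"
  by (simp add: evlattid_def two_sided_ideal_def)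

text \<open>The assumption \<open>0 \<in> S\<close> makes the zero ideal a candidate, so the search
  for one of greatest dimension starts from a nonempty family.\<close>

lemma MaxEvid_nonempty:
  assumes "finite_dimensional_vector_space scale Basis" and "0 \<in> S"
  shows "MaxEvid S \<noteq> {}"
proof -
  interpret finite_dimensional_vector_space scale Basis by fact
  let ?P = "\<lambda>M. M \<in> evlattid \<and> M \<subseteq> S"
  have "?P {0}" using zero_in_evlattid assms(2) by simp
  \<comment> \<open>All dimensions are at most \<open>dimension\<close>, hence strictly below
    \<open>Suc dimension\<close>; bounded naturals attain a maximum.\<close>
  then obtain M where M: "?P M" and max: "\<And>N. ?P N \<Longrightarrow> dim N \<le> dim M"
    using ex_has_greatest_nat[of ?P "{0}" dim "Suc dimension"] dim_subset_UNIV
    by (auto simp: less_Suc_eq_le)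
  have "M \<in> MaxEvid S"
    unfolding MaxEvid_def using M max subspace_dim_equal evlattid_subspace by blast
  then show ?thesis by blast
qed

text \<open>Here it matters that the whole algebra is an evolution algebra: \<open>UNIV\<close> is
  then a candidate for every \<open>S\<close>, and well-ordering of the naturals gives one of least
  dimension.\<close>

lemma MinEvid_nonempty:
  assumes "finite_dimensional_vector_space scale Basis" and "evolution_algebra_on UNIV"
  shows "MinEvid S \<noteq> {}"
proof -
  interpret finite_dimensional_vector_space scale Basis by fact
  let ?P = "\<lambda>M. M \<in> evlattid \<and> S \<subseteq> M"
  have "?P UNIV" using assms(2) by (simp add: evlattid_def two_sided_ideal_UNIV)
  then obtain M where M: "?P M" and min: "\<And>N. ?P N \<Longrightarrow> dim M \<le> dim N"
    using ex_has_least_nat[of ?P UNIV dim] by auto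
  have "M \<in> MinEvid S"
    unfolding MinEvid_def using M min subspace_dim_equal evlattid_subspace by blast
  then show ?thesis by blast
qed

lemma lattid_simps:
  "carrier lattid = {I. two_sided_ideal I}"
  "x \<sqsubseteq>\<^bsub>lattid\<^esub> y \<longleftrightarrow> x \<subseteq> y"
  by (simp_all add: lattid_def)

text \<open>Stated for any family of ideals, so that it serves both the lattice property of
  \<open>lattid\<close> and the two-element sets of \<open>evlattice\<close>.\<close>

lemma greatest_lattid_inf:
  assumes "P \<subseteq> carrier lattid"
  shows "greatest lattid (lattid_inf P) (Lower lattid P)"
  using assms two_sided_ideal_Inter[of P]
  by (auto simp: greatest_def Lower_def lattid_inf_def lattid_simps)

lemma least_lattid_sup:
  assumes "P \<subseteq> carrier lattid"
  shows "least lattid (lattid_sup P) (Upper lattid P)"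
proof -
  have "\<Union>P \<subseteq> lattid_sup P"
    unfolding lattid_sup_def generated_ideal_def by (rule hull_subset)
  \<comment> \<open>An ideal is an upper bound of \<open>P\<close> exactly when it contains the
    union, so minimality of the hull is the least-upper-bound property.\<close>
  moreover have "lattid_sup P \<subseteq> I" if "two_sided_ideal I" "\<Union>P \<subseteq> I" for I
    unfolding lattid_sup_def generated_ideal_def using that(2,1) by (rule hull_minimal)
  ultimately show ?thesis
    using assms two_sided_ideal_generated_ideal[of "\<Union>P"]
    by (simp add: least_def Upper_def lattid_simps lattid_sup_def) blast
qed

lemma lattice_lattid: "lattice lattid"
proof -
  interpret partial_order lattid
    by unfold_locales (auto simp: lattid_def)
  show ?thesis
    by unfold_locales (blast intro: greatest_lattid_inf least_lattid_sup)+
qed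

lemma evlattice_evlattid:
  assumes "finite_dimensional_vector_space scale Basis" and "evolution_algebra_on UNIV"
  shows "evlattice lattid lattid_inf lattid_sup evlattid (\<subseteq>) evinf evsup"
proof (intro evlattice.intro evlattice_axioms.intro lattice_lattid)
  show "evlattid \<subseteq> carrier lattid"
    by (auto simp: evlattid_def lattid_simps)
  show "evinf \<in> nsets evlattid 2 \<rightarrow> nonempty_subsets lattid"
  proof
    fix P assume "P \<in> nsets evlattid 2"
    \<comment> \<open>Every member of \<open>P\<close> is a subspace.\<close>
    then have "0 \<in> \<Inter>P"
      using evlattid_subspace subspace_0 by (auto simp: nsets_def)
    then show "evinf P \<in> nonempty_subsets lattid"
      using MaxEvid_nonempty[OF assms(1), of "\<Inter>P"]
      by (auto simp: nonempty_subsets_def evinf_def MaxEvid_def evlattid_def lattid_simps)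
  qed
  show "evsup \<in> nsets evlattid 2 \<rightarrow> nonempty_subsets lattid"
  proof
    fix P
    show "evsup P \<in> nonempty_subsets lattid"
      using MinEvid_nonempty[OF assms, of "\<Union>P"]
      by (auto simp: nonempty_subsets_def evsup_def MinEvid_def evlattid_def lattid_simps)
  qed
next
  fix P x
  assume "x \<in> evinf P"
  then show "x \<sqsubseteq>\<^bsub>lattid\<^esub> lattid_inf P"
    by (auto simp: evinf_def MaxEvid_def lattid_simps lattid_inf_def)
next
  fix P x
  assume "x \<in> evsup P"
  then have "two_sided_ideal x" "\<Union>P \<subseteq> x"
    by (auto simp: evsup_def MinEvid_def evlattid_def)
  then show "lattid_sup P \<sqsubseteq>\<^bsub>lattid\<^esub> x"
    \<comment> \<open>Members of \<open>MinEvid\<close> are ideals, so containing the union forces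
      containing the ideal it generates.\<close>
    unfolding lattid_simps lattid_sup_def generated_ideal_def by (metis hull_minimal)
\<comment> \<open>What remains is that the bounds of pairs are the lattice ones and that the order
  is inclusion.\<close>
qed (auto simp: lattid_simps(2) nsets_def intro: greatest_lattid_inf least_lattid_sup)

end

theorem theorem25:
  fixes scale :: "'a::field \<Rightarrow> 'b::ab_group_add \<Rightarrow> 'b"
    and mult :: "'b \<Rightarrow> 'b \<Rightarrow> 'b"
  assumes "nonassoc_algebra scale mult"
    and "\<exists>Basis. finite_dimensional_vector_space scale Basis"
    and "nonassoc_algebra.evolution_algebra_on scale mult UNIV"
  shows "evlattice
    (nonassoc_algebra.lattid scale mult)
    (nonassoc_algebra.lattid_inf)
    (nonassoc_algebra.lattid_sup scale mult)
    (nonassoc_algebra.evlattid scale mult)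
    (\<subseteq>)
    (nonassoc_algebra.evinf scale mult)
    (nonassoc_algebra.evsup scale mult)"
  using assms nonassoc_algebra.evlattice_evlattid by blast

end
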